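(* Let $n\ge2$, $c>0$, $p,q\in\mathbb{R}^n$ with $p+q\neq0$, $\omega\in\mathbb{S}^{n-1}$, and $\rho=(p^0+q^0)/\sqrt{s}$. Take $\Lambda$ to be the boost matrix $$\Lambda_b=\begin{pmatrix}\frac{p^0+q^0}{\sqrt{s}} & -\frac{p+q}{\sqrt{s}}\\[2pt] -\frac{p+q}{\sqrt{s}} & \mathbf{1}_n+(\rho-1)\frac{(p+q)\otimes(p+q)}{|p+q|^2}\end{pmatrix}.$$ Then the post-collisional momenta $p'^i=L^{i0}\frac{\sqrt s}{2}-L^{ij}\omega_j\frac{\varrho}{2}$, $q'^i=L^{i0}\frac{\sqrt s}{2}+L^{ij}\omega_j\frac{\varrho}{2}$ ($i=1,\dots,n$) are $$p'=\frac{p+q}{2}+\frac{\varrho}{2}\Big(\omega+(\rho-1)(p+q)\frac{(p+q)\cdot\omega}{|p+q|^2}\Big),\qquad q'=\frac{p+q}{2}-\frac{\varrho}{2}\Big(\omega+(\rho-1)(p+q)\frac{(p+q)\cdot\omega}{|p+q|^2}\Big).$$ Furthermore the post-collisional energies $p'^0=L^{00}\frac{\sqrt s}{2}-L^{0j}\omega_j\frac{\varrho}{2}$, $q'^0=L^{00}\frac{\sqrt s}{2}+L^{0j}\omega_j\frac{\varrho}{2}$ are $$p'^0=\frac{p^0+q^0}{2}+\frac{\varrho}{2\sqrt{s}}(p+q)\cdot\omega,\qquad q'^0=\frac{p^0+q^0}{2}-\frac{\varrho}{2\sqrt{s}}(p+q)\cdot\omega.$$ Additionally, the vector $k\in\mathbb{R}^n$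 with components $k^i=\Lambda^i_{\ \mu}(p^\mu-q^\mu)$ is $$k=-\frac{p+q}{\sqrt{s}}(p^0-q^0)+(p-q)+(\rho-1)(p+q)\frac{(p+q)\cdot(p-q)}{|p+q|^2}.$$
   Context: Notation. For $p\in\mathbb{R}^n$ the energy is $p^0=\sqrt{c^2+|p|^2}$ and $p^\mu=(p^0,p)$; similarly for $q$. Greek indices run over $0,\ldots,n$, Latin indices over $1,\ldots,n$; repeated indices are summed. The Minkowski metric is $(g_{\mu\nu})=\mathrm{diag}(-1,1,\ldots,1)$ with inverse $g^{\mu\nu}$, and $\omega_j=\omega^j$. Set $$\varrho=\sqrt{2(p^0q^0-p\cdot q-c^2)},\qquad s=2(p^0q^0-p\cdot q+c^2).$$ For a matrix $\Lambda=(\Lambda^\mu_{\ \nu})_{0\le\mu,\nu\le n}$ (first index the row, second the column), $L^{\mu\kappa}=-g^{\mu\lambda}\Lambda^\kappa_{\ \lambda}$. $\mathbf{1}_n$ is the $n\times n$ identity matrix. *)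

theory Defs
  imports "HOL-Analysis.Analysis"
begin

text \<open>
  Spacetime indices $0,\ldots,n$ are elements of \<^typ>\<open>'n option\<close>: \<^term>\<open>None\<close> is the index $0$
  and \<^term>\<open>Some i\<close> is the Latin index $i$. In \<^term>\<open>\<Lambda> $ \<mu> $ \<nu>\<close>, \<^term>\<open>\<mu>\<close> is the row.
\<close>

definition four_vector :: "real \<Rightarrow> real ^ 'n \<Rightarrow> real ^ ('n::finite option)" where
  "four_vector x0 x = (\<chi> \<mu>. case \<mu> of None \<Rightarrow> x0 | Some i \<Rightarrow> x $ i)"

definition spatial :: "real ^ ('n::finite option) \<Rightarrow> real ^ 'n" where
  "spatial x = (\<chi> i. x $ Some i)"

definition energy :: "real \<Rightarrow> real ^ 'n::finite \<Rightarrow> real" where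
  "energy c p = sqrt (c\<^sup>2 + (norm p)\<^sup>2)"

definition four_momentum :: "real \<Rightarrow> real ^ 'n \<Rightarrow> real ^ ('n::finite option)" where
  "four_momentum c p = four_vector (energy c p) p"

definition minkowski :: "real ^ ('n::finite option) ^ ('n option)" where
  "minkowski = (\<chi> \<mu> \<nu>. if \<mu> \<noteq> \<nu> then 0 else if \<mu> = None then -1 else 1)"

definition rel_momentum :: "real \<Rightarrow> real ^ 'n::finite \<Rightarrow> real ^ 'n \<Rightarrow> real" where
  "rel_momentum c p q = sqrt (2 * (energy c p * energy c q - p \<bullet> q - c\<^sup>2))"

text \<open>The quantity $s$ itself (the square of the total energy in the centre-of-momentum frame).\<close>

definition cm_energy_sq :: "real \<Rightarrow> real ^ 'n::finite \<Rightarrow> real ^ 'n \<Rightarrow> real" where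
  "cm_energy_sq c p q = 2 * (energy c p * energy c q - p \<bullet> q + c\<^sup>2)"

text \<open>$L^{\mu\kappa} = -g^{\mu\nu}\Lambda^\kappa{}_\nu$: note the transposed index order of \<^term>\<open>\<Lambda>\<close>.\<close>

definition L_matrix :: "real ^ ('n::finite option) ^ ('n option) \<Rightarrow> real ^ ('n option) ^ ('n option)" where
  "L_matrix \<Lambda> = (\<chi> \<mu> \<kappa>. - (\<Sum>\<nu>\<in>UNIV. matrix_inv minkowski $ \<mu> $ \<nu> * \<Lambda> $ \<kappa> $ \<nu>))"

definition boost_rho :: "real \<Rightarrow> real ^ 'n::finite \<Rightarrow> real ^ 'n \<Rightarrow> real" where
  "boost_rho c p q = (energy c p + energy c q) / sqrt (cm_energy_sq c p q)"

definition boost_matrix ::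
  "real \<Rightarrow> real ^ 'n::finite \<Rightarrow> real ^ 'n \<Rightarrow> real ^ ('n option) ^ ('n option)" where
  "boost_matrix c p q = (\<chi> \<mu> \<nu>.
     case (\<mu>, \<nu>) of
       (None, None) \<Rightarrow> (energy c p + energy c q) / sqrt (cm_energy_sq c p q)
     | (None, Some j) \<Rightarrow> - ((p + q) $ j) / sqrt (cm_energy_sq c p q)
     | (Some i, None) \<Rightarrow> - ((p + q) $ i) / sqrt (cm_energy_sq c p q)
     | (Some i, Some j) \<Rightarrow> (mat 1 :: real ^ 'n ^ 'n) $ i $ j
         + (boost_rho c p q - 1) * ((p + q) $ i * (p + q) $ j) / (norm (p + q))\<^sup>2)"

text \<open>
  The post-collisional four-vectors $p'^\mu$ and $q'^\mu$ determined by a matrix \<^term>\<open>\<Lambda>\<close>. Their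
  component \<^term>\<open>None\<close> is the post-collisional energy, given by the same formula as the momenta.
\<close>

definition post_p ::
  "real \<Rightarrow> real ^ 'n::finite \<Rightarrow> real ^ 'n \<Rightarrow> real ^ ('n option) ^ ('n option) \<Rightarrow> real ^ 'n
     \<Rightarrow> real ^ ('n option)" where
  "post_p c p q \<Lambda> \<omega> = (\<chi> \<mu>.
     L_matrix \<Lambda> $ \<mu> $ None * (sqrt (cm_energy_sq c p q) / 2)
     - (\<Sum>j\<in>UNIV. L_matrix \<Lambda> $ \<mu> $ Some j * \<omega> $ j) * (rel_momentum c p q / 2))"

definition post_q ::
  "real \<Rightarrow> real ^ 'n::finite \<Rightarrow> real ^ 'n \<Rightarrow> real ^ ('n option) ^ ('n option) \<Rightarrow> real ^ 'n
     \<Rightarrow> real ^ ('n option)" where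
  "post_q c p q \<Lambda> \<omega> = (\<chi> \<mu>.
     L_matrix \<Lambda> $ \<mu> $ None * (sqrt (cm_energy_sq c p q) / 2)
     + (\<Sum>j\<in>UNIV. L_matrix \<Lambda> $ \<mu> $ Some j * \<omega> $ j) * (rel_momentum c p q / 2))"

end

theory Submission
  imports Defs
begin

text \<open>
  The inverse of the Minkowski metric is the metric itself, so raising an index only flips the sign
  of the time component: \<^term>\<open>L_matrix \<Lambda>\<close> is the transpose of \<^term>\<open>\<Lambda>\<close> with its
  spatial rows negated. Since the inverse of the boost is the boost with the opposite velocity,
  this makes the post-collisional four-vectors the inverse boosts of
  $(\sqrt s / 2, \pm \varrho\,\omega / 2)$, the outgoing particles in the centre-of-momentum frame;
  similarly, $k$ is the spatial part of the boosted relative four-momentum.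

  Two facts carry the computation. The total momentum $P = p + q$ enters the spatial block
  of the boost as a rank-one perturbation of the identity, so that the block is symmetric and maps
  $v$ to $v + (\rho - 1)\,(P \cdot v)\,P / |P|^2$; this gives the momenta (with $v = \omega$) and
  $k$ (with $v = p - q$). And $s > 0$, by the Cauchy--Schwarz inequality, so that the factor
  $\sqrt s / 2$ cancels the $1 / \sqrt s$ in the time row of the boost and leaves half of the total
  momentum and energy.
\<close>

lemma sum_UNIV_option:
  fixes f :: "'a::finite option \<Rightarrow> 'b::comm_monoid_add"
  shows "(\<Sum>x\<in>UNIV. f x) = f None + (\<Sum>i\<in>UNIV. f (Some i))"
  by (simp add: UNIV_option_conv sum.reindex)

lemma matrix_inv_involution:
  fixes A :: "'a::semiring_1 ^ 'n::finite ^ 'n"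
  assumes "A ** A = mat 1"
  shows "matrix_inv A = A"
proof -
  have "A ** matrix_inv A = mat 1"
    unfolding matrix_inv_def using someI[of "\<lambda>B. A ** B = mat 1 \<and> B ** A = mat 1" A] assms by blast
  then have "A ** A ** matrix_inv A = A"
    by (simp flip: matrix_mul_assoc)
  then show ?thesis
    by (simp add: assms)
qed

lemma matrix_inv_minkowski:
  "matrix_inv minkowski = (minkowski :: real ^ ('n::finite option) ^ ('n option))"
proof (rule matrix_inv_involution)
  have "(minkowski :: real ^ ('n option) ^ ('n option)) $ \<mu> $ \<kappa> * minkowski $ \<kappa> $ \<nu>
      = (if \<kappa> = \<mu> then mat 1 $ \<mu> $ \<nu> else 0)" for \<mu> \<nu> \<kappa>
    by (simp add: minkowski_def mat_def)
  then show "minkowski ** minkowski = (mat 1 :: real ^ ('n option) ^ ('n option))"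
    by (simp add: vec_eq_iff matrix_matrix_mult_def)
qed

lemma L_matrix_component:
  "L_matrix \<Lambda> $ \<mu> $ \<kappa> = (if \<mu> = None then \<Lambda> $ \<kappa> $ None else - \<Lambda> $ \<kappa> $ \<mu>)"
proof -
  have "minkowski $ \<mu> $ \<nu> * \<Lambda> $ \<kappa> $ \<nu>
      = (if \<nu> = \<mu> then (if \<mu> = None then -1 else 1) * \<Lambda> $ \<kappa> $ \<mu> else 0)" for \<nu>
    by (simp add: minkowski_def)
  then show ?thesis
    by (simp add: L_matrix_def matrix_inv_minkowski)
qed

text \<open>
  Each energy dominates the norm of its momentum, so $p^0 q^0 \ge |p|\,|q| \ge p \cdot q$, and the
  remaining term $c^2$ is positive.
\<close>

lemma cm_energy_sq_pos:
  fixes p q :: "real ^ 'n::finite"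
  assumes "c \<noteq> 0"
  shows "cm_energy_sq c p q > 0"
proof -
  have "norm x \<le> energy c x" for x :: "real ^ 'n"
    unfolding energy_def by (rule real_le_rsqrt) simp
  then have "norm p * norm q \<le> energy c p * energy c q"
    by (simp add: mult_mono')
  then have "p \<bullet> q \<le> energy c p * energy c q"
    using norm_cauchy_schwarz order_trans by blast
  then show ?thesis
    unfolding cm_energy_sq_def using assms by (simp add: add_nonneg_pos)
qed

lemma boost_matrix_symmetric: "boost_matrix c p q $ \<mu> $ \<nu> = boost_matrix c p q $ \<nu> $ \<mu>"
  by (simp add: boost_matrix_def mat_def mult.commute split: option.split)

lemma boost_matrix_time_row:
  "(\<Sum>j\<in>UNIV. boost_matrix c p q $ None $ Some j * v $ j)
     = - ((p + q) \<bullet> v) / sqrt (cm_energy_sq c p q)"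
  by (simp add: boost_matrix_def inner_vec_def sum_divide_distrib sum_negf
      del: vector_add_component minus_add_distrib)

text \<open>
  Row $i$ of the spatial block is $e_i + a P$ with $P = p + q$ and $a = (\<rho> - 1) P_i / |P|^2$, so
  its product with $v$ is $v_i + a\,(P \cdot v)$.
\<close>

lemma boost_matrix_spatial_block:
  "(\<Sum>j\<in>UNIV. boost_matrix c p q $ Some i $ Some j * v $ j)
     = (v + ((boost_rho c p q - 1) * (((p + q) \<bullet> v) / (norm (p + q))\<^sup>2)) *\<^sub>R (p + q)) $ i"
proof -
  define a where "a = (boost_rho c p q - 1) * (p + q) $ i / (norm (p + q))\<^sup>2"
  have "(\<Sum>j\<in>UNIV. boost_matrix c p q $ Some i $ Some j * v $ j)
      = (\<Sum>j\<in>UNIV. (if i = j then v $ j else 0) + a * ((p + q) $ j * v $ j))"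
    by (intro sum.cong refl) (simp add: boost_matrix_def mat_def a_def algebra_simps)
  also have "\<dots> = v $ i + a * ((p + q) \<bullet> v)"
    by (simp add: sum.distrib inner_vec_def flip: sum_distrib_left)
  finally show ?thesis
    by (simp add: a_def mult_ac)
qed

theorem corollary3:
  fixes c \<rho> s r :: real
    and p q \<omega> k :: "real ^ 'n::finite"
    and \<Lambda> :: "real ^ ('n option) ^ ('n option)"
  assumes "CARD('n) \<ge> 2"
    and "c > 0"
    and "p + q \<noteq> 0"
    and "\<omega> \<in> sphere 0 1"
    and "s = cm_energy_sq c p q"
    and "r = rel_momentum c p q"
    and "\<rho> = (energy c p + energy c q) / sqrt s"
    and "\<Lambda> = boost_matrix c p q"
    and "k = spatial (\<Lambda> *v (four_momentum c p - four_momentum c q))"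
  shows
    "spatial (post_p c p q \<Lambda> \<omega>) =
       (1 / 2) *\<^sub>R (p + q)
       + (r / 2) *\<^sub>R (\<omega> + ((\<rho> - 1) * (((p + q) \<bullet> \<omega>) / (norm (p + q))\<^sup>2)) *\<^sub>R (p + q))
     \<and> spatial (post_q c p q \<Lambda> \<omega>) =
       (1 / 2) *\<^sub>R (p + q)
       - (r / 2) *\<^sub>R (\<omega> + ((\<rho> - 1) * (((p + q) \<bullet> \<omega>) / (norm (p + q))\<^sup>2)) *\<^sub>R (p + q))
     \<and> post_p c p q \<Lambda> \<omega> $ None =
       (energy c p + energy c q) / 2 + r / (2 * sqrt s) * ((p + q) \<bullet> \<omega>)
     \<and> post_q c p q \<Lambda> \<omega> $ None =
       (energy c p + energy c q) / 2 - r / (2 * sqrt s) * ((p + q) \<bullet> \<omega>)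
     \<and> k = - ((energy c p - energy c q) / sqrt s) *\<^sub>R (p + q) + (p - q)
       + ((\<rho> - 1) * (((p + q) \<bullet> (p - q)) / (norm (p + q))\<^sup>2)) *\<^sub>R (p + q)"
proof -
  let ?P = "p + q" and ?B = "boost_matrix c p q"
  have s_pos: "s > 0"
    using assms(2,5) cm_energy_sq_pos[of c p q] by simp
  have \<rho>: "\<rho> = boost_rho c p q"
    using assms(5,7) by (simp add: boost_rho_def)
  have time_time: "?B $ None $ None = (energy c p + energy c q) / sqrt s"
    and space_time: "?B $ Some i $ None = - (?P $ i / sqrt s)" for i
    using assms(5) by (simp_all add: boost_matrix_def del: vector_add_component)
  have time_row: "(\<Sum>j\<in>UNIV. ?B $ None $ Some j * v $ j) = - (?P \<bullet> v) / sqrt s" for v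
    using boost_matrix_time_row[of c p q v] assms(5) by simp
  note block = boost_matrix_spatial_block[of c p q, folded \<rho>]
  \<comment> \<open>The contraction with \<open>\<omega>\<close> runs over the row index of the boost; symmetry turns it into a
    matrix-vector product.\<close>
  have L_time: "(\<Sum>j\<in>UNIV. L_matrix \<Lambda> $ None $ Some j * \<omega> $ j) = - (?P \<bullet> \<omega>) / sqrt s"
    using time_row[of \<omega>]
    by (simp add: L_matrix_component assms(8) boost_matrix_symmetric[of c p q "Some _" None])
  define W where "W = \<omega> + ((\<rho> - 1) * ((?P \<bullet> \<omega>) / (norm ?P)\<^sup>2)) *\<^sub>R ?P"
  have L_space: "(\<Sum>j\<in>UNIV. L_matrix \<Lambda> $ Some i $ Some j * \<omega> $ j)
      = - W $ i" for i
    unfolding L_matrix_component assms(8) W_def block[symmetric]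
    by (simp add: boost_matrix_symmetric[of c p q "Some _" "Some i"] sum_negf)
  have L_time0: "L_matrix \<Lambda> $ None $ None * (sqrt s / 2) = (energy c p + energy c q) / 2"
    using s_pos by (simp add: L_matrix_component assms(8) time_time)
  have L_space0: "L_matrix \<Lambda> $ Some i $ None * (sqrt s / 2) = ?P $ i / 2" for i
    using s_pos boost_matrix_symmetric[of c p q None "Some i"]
    by (simp add: L_matrix_component assms(8) space_time del: vector_add_component)
  have "k $ i = ?B $ Some i $ None * (energy c p - energy c q)
      + (\<Sum>j\<in>UNIV. ?B $ Some i $ Some j * (p - q) $ j)" for i
    by (simp add: assms(8,9) spatial_def matrix_vector_mult_def sum_UNIV_option four_momentum_def
        four_vector_def)
  then have k: "k = - ((energy c p - energy c q) / sqrt s) *\<^sub>R ?P + (p - q)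
      + ((\<rho> - 1) * ((?P \<bullet> (p - q)) / (norm ?P)\<^sup>2)) *\<^sub>R ?P"
    unfolding vec_eq_iff block space_time by (simp add: mult_ac)
  have p_time: "post_p c p q \<Lambda> \<omega> $ None = (energy c p + energy c q) / 2 + r / (2 * sqrt s) * (?P \<bullet> \<omega>)"
    and q_time: "post_q c p q \<Lambda> \<omega> $ None = (energy c p + energy c q) / 2 - r / (2 * sqrt s) * (?P \<bullet> \<omega>)"
    unfolding post_p_def post_q_def vec_lambda_beta assms(5,6)[symmetric] L_time L_time0
    by (simp_all add: mult_ac)
  have p_space: "spatial (post_p c p q \<Lambda> \<omega>) = (1 / 2) *\<^sub>R ?P + (r / 2) *\<^sub>R W"
    and q_space: "spatial (post_q c p q \<Lambda> \<omega>) = (1 / 2) *\<^sub>R ?P - (r / 2) *\<^sub>R W"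
    unfolding vec_eq_iff spatial_def post_p_def post_q_def vec_lambda_beta assms(5,6)[symmetric]
      L_space L_space0 by simp_all
  show ?thesis
    using p_space q_space p_time q_time k unfolding W_def by blast
qed

end
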